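(* Consider the system $$X_0(t)=0,\qquad \dot{X}_n(t)=k_{n-1}X_{n-1}^2(t)-k_nX_n(t)X_{n+1}(t)\quad (n\ge 1),\qquad k_n=2^n.$$ Let $X$ be a finite energy, not identically zero, self-similar solution $X_n(t)=\frac{a_n}{t-t_0}$, $t>t_0$, with $t_0<0$. Then all its values are coalescence points, in the sense that for all $t_1>t_0$ there exists a finite energy solution $X^{t_1}$, defined for $t\in(-\infty,t_1]$, such that $X^{t_1}(t_1)=X(t_1)$ and $X^{t_1}(t)\neq X(t)$ for all $t\in(t_0,t_1)$.
   Context: For $t_0<0$, a self-similar solution is a solution of the form $X_n(t)=\frac{a_n}{t-t_0}$, $t>t_0$, $n\ge1$, with real coefficients $a_n$, satisfying all equations of the system for $t>t_0$; it has finite energy if $\sum_{n\ge1}a_n^2<\infty$. A finite energy solution on $(-\infty,t_1]$ is a sequence $(X_n(\cdot))_{n\ge1}$ of continuously differentiable real functions on $(-\infty,t_1]$ satisfying all equations of the system for all $t\le t_1$ (no sign condition is required) and such that $\sum_{n\ge1}X_n(t)^2<\infty$ for all $t\le t_1$. *)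

theory Defs
  imports Complex_Main
begin

text \<open>A time-dependent state is a function of type \<open>real \<Rightarrow> nat \<Rightarrow> real\<close>, so that \<open>X t n\<close> is \<open>X\<^sub>n(t)\<close>. The index \<open>0\<close>
  carries the boundary condition \<open>X\<^sub>0 = 0\<close>; the unknowns are the \<open>X\<^sub>n\<close> with \<open>n \<ge> 1\<close>.\<close>

definition wavenumber :: "nat \<Rightarrow> real" where
  "wavenumber n = 2 ^ n"

text \<open>At an endpoint belonging to \<open>S\<close>, the derivative below is the one-sided one.\<close>

definition solves_system_on :: "real set \<Rightarrow> (real \<Rightarrow> nat \<Rightarrow> real) \<Rightarrow> bool" where
  "solves_system_on S X \<longleftrightarrow>
     (\<forall>t\<in>S. X t 0 = 0) \<and>
     (\<forall>t\<in>S. \<forall>n\<ge>1.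
        ((\<lambda>s. X s n) has_real_derivative
           (wavenumber (n - 1) * (X t (n - 1))\<^sup>2 - wavenumber n * X t n * X t (n + 1))) (at t within S))"

definition continuously_differentiable_on :: "real set \<Rightarrow> (real \<Rightarrow> real) \<Rightarrow> bool" where
  "continuously_differentiable_on S f \<longleftrightarrow>
     (\<exists>f'. continuous_on S f' \<and> (\<forall>t\<in>S. (f has_real_derivative f' t) (at t within S)))"

text \<open>The sum runs over \<open>n \<ge> 1\<close>, whence the shift.\<close>

definition finite_energy :: "(nat \<Rightarrow> real) \<Rightarrow> bool" where
  "finite_energy x \<longleftrightarrow> summable (\<lambda>n. (x (Suc n))\<^sup>2)"

definition self_similar_solution ::
    "real \<Rightarrow> (nat \<Rightarrow> real) \<Rightarrow> (real \<Rightarrow> nat \<Rightarrow> real) \<Rightarrow> bool" where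
  "self_similar_solution t0 a X \<longleftrightarrow>
     (\<forall>t>t0. \<forall>n\<ge>1. X t n = a n / (t - t0)) \<and> solves_system_on {t0<..} X"

definition finite_energy_solution_upto :: "real \<Rightarrow> (real \<Rightarrow> nat \<Rightarrow> real) \<Rightarrow> bool" where
  "finite_energy_solution_upto t1 X \<longleftrightarrow>
     (\<forall>n\<ge>1. continuously_differentiable_on {..t1} (\<lambda>t. X t n)) \<and>
     solves_system_on {..t1} X \<and>
     (\<forall>t\<le>t1. finite_energy (X t))"

end

theory Submission
  imports Defs "HOL-Complex_Analysis.Great_Picard"
begin

text \<open>The right-hand side is quadratic, so \<open>Z \<mapsto> (t \<mapsto> - Z (t1 - t))\<close> maps forward solutions to
  backward ones. The datum \<open>- X t1\<close> has a forward solution whose energy never exceeds the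
  initial one, obtained as a limit of Galerkin--Euler approximations. Reversing it gives a solution on
  \<open>{..t1}\<close> that ends in \<open>X t1\<close> with energy at most \<open>A / (t1 - t0)\<^sup>2\<close>, where \<open>A > 0\<close> is the sum of
  the \<open>(a n)\<^sup>2\<close>, whereas for \<open>t < t1\<close> the energy \<open>A / (t - t0)\<^sup>2\<close> of \<open>X t\<close> is strictly larger.\<close>

section \<open>The quadratic vector field: conservation and bounds\<close>

text \<open>Subtraction on the naturals makes the formula total: at index 0 it reads
  \<open>(x 0)^2 - x 0 * x 1\<close>, which vanishes under the boundary condition. Index 0 can
  therefore be included in all later sums and estimates.\<close>

definition dyadic_field :: "(nat \<Rightarrow> real) \<Rightarrow> nat \<Rightarrow> real" where
  "dyadic_field x n = wavenumber (n - 1) * (x (n - 1))\<^sup>2 - wavenumber n * x n * x (n + 1)"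

lemma dyadic_field_0 [simp]: "x 0 = 0 \<Longrightarrow> dyadic_field x 0 = 0"
  by (simp add: dyadic_field_def)

lemma wavenumber_nonneg [simp]: "0 \<le> wavenumber n"
  by (simp add: wavenumber_def)

lemma wavenumber_mono: "m \<le> n \<Longrightarrow> wavenumber m \<le> wavenumber n"
  by (simp add: wavenumber_def)

lemma dyadic_field_uminus: "dyadic_field (\<lambda>m. - x m) n = dyadic_field x n"
  by (simp add: dyadic_field_def)

text \<open>The sum telescopes: the energy that mode n passes on through its second term is what
  mode n + 1 receives through its first. What remains is the flux out of mode N, and this is zero
  for a state truncated at N.\<close>

lemma dyadic_field_orthogonal:
  assumes "x 0 = 0"
  shows "(\<Sum>n\<le>N. x n * dyadic_field x n) = - wavenumber N * (x N)\<^sup>2 * x (Suc N)"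
proof (induction N)
  case 0
  then show ?case using assms by simp
next
  case (Suc N)
  then show ?case
    by (simp add: dyadic_field_def algebra_simps power2_eq_square)
qed

text \<open>One factor of each product is bounded by R and the other is kept. The bound stays linear
  in the neighbouring modes, so that its square can be summed against the energy.\<close>

lemma abs_dyadic_field_le:
  assumes x: "\<And>n. \<bar>x n\<bar> \<le> R"
  shows "\<bar>dyadic_field x n\<bar> \<le> wavenumber n * R * (\<bar>x (n - 1)\<bar> + \<bar>x (n + 1)\<bar>)"
proof -
  have R: "0 \<le> R" using x[of 0] by linarith
  have "wavenumber (n - 1) * (\<bar>x (n - 1)\<bar> * \<bar>x (n - 1)\<bar>) \<le> wavenumber n * (R * \<bar>x (n - 1)\<bar>)"
    by (intro mult_mono wavenumber_mono x) (auto simp: R)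
  moreover have "wavenumber n * (\<bar>x n\<bar> * \<bar>x (n + 1)\<bar>) \<le> wavenumber n * (R * \<bar>x (n + 1)\<bar>)"
    by (intro mult_mono x) (auto simp: R)
  moreover have "\<bar>dyadic_field x n\<bar> \<le> wavenumber (n - 1) * (\<bar>x (n - 1)\<bar> * \<bar>x (n - 1)\<bar>)
      + wavenumber n * (\<bar>x n\<bar> * \<bar>x (n + 1)\<bar>)"
    unfolding dyadic_field_def
    by (rule order_trans[OF abs_triangle_ineq4]) (simp add: abs_mult power2_eq_square mult.assoc)
  ultimately show ?thesis by (simp add: algebra_simps)
qed

lemma abs_dyadic_field_le_const:
  assumes x: "\<And>n. \<bar>x n\<bar> \<le> R"
  shows "\<bar>dyadic_field x n\<bar> \<le> 2 * wavenumber n * R\<^sup>2"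
proof -
  have R: "0 \<le> R" using x[of 0] by linarith
  have "\<bar>dyadic_field x n\<bar> \<le> wavenumber n * R * (\<bar>x (n - 1)\<bar> + \<bar>x (n + 1)\<bar>)"
    by (rule abs_dyadic_field_le[OF x])
  also have "\<dots> \<le> wavenumber n * R * (R + R)"
    by (intro mult_left_mono add_mono x) (auto simp: R)
  finally show ?thesis by (simp add: power2_eq_square algebra_simps)
qed

text \<open>Mode n of the field reads no mode above n + 1, so closeness is required only up to
  there. Each of the two products changes by at most \<open>2 * R * d\<close>, which gives the
  constant 4.\<close>

lemma dyadic_field_lipschitz:
  assumes x: "\<And>n. \<bar>x n\<bar> \<le> R" and y: "\<And>n. \<bar>y n\<bar> \<le> R"
    and d: "\<And>m. m \<le> n + 1 \<Longrightarrow> \<bar>x m - y m\<bar> \<le> d"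
  shows "\<bar>dyadic_field x n - dyadic_field y n\<bar> \<le> 4 * R * wavenumber n * d"
proof -
  have R: "0 \<le> R" and d0: "0 \<le> d" using x[of 0] d[of 0] by linarith+
  have *: "\<bar>x i * x j - y i * y j\<bar> \<le> 2 * R * d" if "i \<le> n + 1" "j \<le> n + 1" for i j
  proof -
    have "x i * x j - y i * y j = x i * (x j - y j) + y j * (x i - y i)"
      by (simp add: algebra_simps)
    then have "\<bar>x i * x j - y i * y j\<bar> \<le> \<bar>x i\<bar> * \<bar>x j - y j\<bar> + \<bar>y j\<bar> * \<bar>x i - y i\<bar>"
      by (metis abs_mult abs_triangle_ineq)
    also have "\<dots> \<le> R * d + R * d"
      by (intro add_mono mult_mono x y d that) (auto simp: R)
    finally show ?thesis by simp
  qed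
  have "dyadic_field x n - dyadic_field y n =
      wavenumber (n - 1) * (x (n - 1) * x (n - 1) - y (n - 1) * y (n - 1))
      - wavenumber n * (x n * x (n + 1) - y n * y (n + 1))"
    by (simp add: dyadic_field_def power2_eq_square algebra_simps)
  also have "\<bar>\<dots>\<bar> \<le> wavenumber (n - 1) * \<bar>x (n - 1) * x (n - 1) - y (n - 1) * y (n - 1)\<bar>
      + wavenumber n * \<bar>x n * x (n + 1) - y n * y (n + 1)\<bar>"
    by (rule order_trans[OF abs_triangle_ineq4]) (simp add: abs_mult)
  also have "\<dots> \<le> wavenumber n * (2 * R * d) + wavenumber n * (2 * R * d)"
    by (intro add_mono mult_mono * wavenumber_mono) auto
  finally show ?thesis by (simp add: algebra_simps)
qed

text \<open>On modes up to N the wavenumbers are at most \<open>2 ^ N\<close>, so the truncated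
  field grows at most linearly in the state. The constant 4 has one factor 2 from
  \<open>(p + q)^2 \<le> 2 * (p^2 + q^2)\<close> and another from the two shifted sums, each at most
  the energy.\<close>

lemma sum_dyadic_field_squared_le:
  assumes x: "\<And>n. \<bar>x n\<bar> \<le> R" and x0: "x 0 = 0" and xN: "x (Suc N) = 0"
  shows "(\<Sum>n\<le>N. (dyadic_field x n)\<^sup>2) \<le> 4 * (2 ^ N * R)\<^sup>2 * (\<Sum>n\<le>N. (x n)\<^sup>2)"
proof -
  have R: "0 \<le> R" using x[of 0] by linarith
  have "(dyadic_field x n)\<^sup>2 \<le> 2 * (2 ^ N * R)\<^sup>2 * ((x (n - 1))\<^sup>2 + (x (Suc n))\<^sup>2)" if "n \<le> N" for n
  proof -
    have "\<bar>dyadic_field x n\<bar> \<le> (2 ^ N * R) * (\<bar>x (n - 1)\<bar> + \<bar>x (n + 1)\<bar>)"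
      by (rule order_trans[OF abs_dyadic_field_le[where x = x and n = n, OF x]])
        (use that in \<open>auto intro!: mult_right_mono simp: R wavenumber_def\<close>)
    then have "(dyadic_field x n)\<^sup>2 \<le> ((2 ^ N * R) * (\<bar>x (n - 1)\<bar> + \<bar>x (n + 1)\<bar>))\<^sup>2"
      by (metis abs_ge_zero power2_abs power_mono)
    also have "\<dots> = (2 ^ N * R)\<^sup>2 * (\<bar>x (n - 1)\<bar> + \<bar>x (n + 1)\<bar>)\<^sup>2"
      by (simp only: power_mult_distrib)
    also have "\<dots> \<le> (2 ^ N * R)\<^sup>2 * (2 * ((x (n - 1))\<^sup>2 + (x (Suc n))\<^sup>2))"
    proof (rule mult_left_mono)
      show "(\<bar>x (n - 1)\<bar> + \<bar>x (n + 1)\<bar>)\<^sup>2 \<le> 2 * ((x (n - 1))\<^sup>2 + (x (Suc n))\<^sup>2)"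
        using sum_squares_bound[of "\<bar>x (n - 1)\<bar>" "\<bar>x (n + 1)\<bar>"] by (simp add: power2_sum)
    qed simp
    finally show ?thesis by (simp only: mult_ac)
  qed
  then have "(\<Sum>n\<le>N. (dyadic_field x n)\<^sup>2)
      \<le> (\<Sum>n\<le>N. 2 * (2 ^ N * R)\<^sup>2 * ((x (n - 1))\<^sup>2 + (x (Suc n))\<^sup>2))"
    by (intro sum_mono) auto
  also have "\<dots> = 2 * (2 ^ N * R)\<^sup>2 * ((\<Sum>n\<le>N. (x (n - 1))\<^sup>2) + (\<Sum>n\<le>N. (x (Suc n))\<^sup>2))"
    by (simp only: sum_distrib_left[symmetric] sum.distrib)
  also have "\<dots> \<le> 2 * (2 ^ N * R)\<^sup>2 * ((\<Sum>n\<le>N. (x n)\<^sup>2) + (\<Sum>n\<le>N. (x n)\<^sup>2))"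
  proof (intro mult_left_mono add_mono)
    \<comment> \<open>Indices 0 and 1 both refer to mode 0 here; the duplicate is harmless because
      \<open>x 0 = 0\<close>.\<close>
    have "(\<Sum>n\<le>N. (x (n - 1))\<^sup>2) = (\<Sum>n<N. (x n)\<^sup>2)"
      using x0 by (cases N) (simp_all only: sum.atMost_Suc_shift lessThan_Suc_atMost, simp_all)
    also have "\<dots> \<le> (\<Sum>n\<le>N. (x n)\<^sup>2)" by (rule sum_mono2) auto
    finally show "(\<Sum>n\<le>N. (x (n - 1))\<^sup>2) \<le> (\<Sum>n\<le>N. (x n)\<^sup>2)" .
    have "(\<Sum>n\<le>N. (x n)\<^sup>2) = (\<Sum>n\<le>Suc N. (x n)\<^sup>2)" using xN by simp
    also have "\<dots> = (\<Sum>n\<le>N. (x (Suc n))\<^sup>2)" 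
      unfolding sum.atMost_Suc_shift using x0 by simp
    finally show "(\<Sum>n\<le>N. (x (Suc n))\<^sup>2) \<le> (\<Sum>n\<le>N. (x n)\<^sup>2)" by simp
  qed auto
  finally show ?thesis by simp
qed

section \<open>The damped Euler scheme for the truncated system\<close>

text \<open>Explicit Euler steps of length h, with datum x and step number j, for the Galerkin
  truncation to modes up to N. Higher modes are kept at zero, and the division by
  \<open>1 + \<epsilon>\<close> is the damping.\<close>

fun damped_euler :: "real \<Rightarrow> real \<Rightarrow> nat \<Rightarrow> (nat \<Rightarrow> real) \<Rightarrow> nat \<Rightarrow> nat \<Rightarrow> real" where
  "damped_euler h \<epsilon> N x 0 n = (if n \<le> N then x n else 0)"
| "damped_euler h \<epsilon> N x (Suc j) n = (if n \<le> N then
     (damped_euler h \<epsilon> N x j n + h * dyadic_field (damped_euler h \<epsilon> N x j) n) / (1 + \<epsilon>) else 0)"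

lemma damped_euler_beyond [simp]: "N < n \<Longrightarrow> damped_euler h \<epsilon> N x j n = 0"
  by (cases j) auto

lemma damped_euler_mode_0 [simp]: "x 0 = 0 \<Longrightarrow> damped_euler h \<epsilon> N x j 0 = 0"
  by (induction j) auto

lemma abs_le_of_sum_squares_le:
  fixes x :: "nat \<Rightarrow> real"
  assumes "(\<Sum>n\<le>N. (x n)\<^sup>2) \<le> R\<^sup>2" "0 \<le> R" "\<And>n. N < n \<Longrightarrow> x n = 0"
  shows "\<bar>x n\<bar> \<le> R"
proof (cases "n \<le> N")
  case True
  then have "(x n)\<^sup>2 \<le> (\<Sum>n\<le>N. (x n)\<^sup>2)" by (intro member_le_sum) auto
  then show ?thesis using assms abs_le_square_iff[of "x n" R] by simp
qed (use assms in auto)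

text \<open>Orthogonality makes the explicit step increase the energy only by a factor
  \<open>1 + O(h\<^sup>2)\<close>, which the damping compensates.\<close>

lemma damped_euler_energy:
  assumes x0: "x 0 = 0" and R: "0 \<le> R" and xR: "(\<Sum>n\<le>N. (x n)\<^sup>2) \<le> R\<^sup>2"
    and \<epsilon>: "4 * (h * (2 ^ N * R))\<^sup>2 \<le> \<epsilon>"
  shows "(\<Sum>n\<le>N. (damped_euler h \<epsilon> N x j n)\<^sup>2) \<le> R\<^sup>2"
proof (induction j)
  case 0
  then show ?case using xR by simp
next
  case (Suc j)
  define y where "y = damped_euler h \<epsilon> N x j"
  have yR: "\<bar>y n\<bar> \<le> R" for n
    by (rule abs_le_of_sum_squares_le[OF Suc[folded y_def] R]) (simp add: y_def)
  have \<epsilon>0: "0 \<le> \<epsilon>" using \<epsilon> by (rule order_trans[rotated]) simp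
  have y0: "y 0 = 0" "y (Suc N) = 0" using x0 by (simp_all add: y_def)
  have S: "0 \<le> (\<Sum>n\<le>N. (y n)\<^sup>2)" by (simp add: sum_nonneg)
  have "(\<Sum>n\<le>N. (y n + h * dyadic_field y n)\<^sup>2) = (\<Sum>n\<le>N. (y n)\<^sup>2)
      + 2 * h * (\<Sum>n\<le>N. y n * dyadic_field y n) + h\<^sup>2 * (\<Sum>n\<le>N. (dyadic_field y n)\<^sup>2)"
    by (simp add: sum_distrib_left sum.distrib[symmetric] power2_sum power_mult_distrib algebra_simps)
  \<comment> \<open>The cross term equals the flux out of mode N and vanishes since
    \<open>y (Suc N) = 0\<close>.\<close>
  also have "\<dots> = (\<Sum>n\<le>N. (y n)\<^sup>2) + h\<^sup>2 * (\<Sum>n\<le>N. (dyadic_field y n)\<^sup>2)"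
    by (simp add: dyadic_field_orthogonal y0)
  also have "\<dots> \<le> (\<Sum>n\<le>N. (y n)\<^sup>2) + h\<^sup>2 * (4 * (2 ^ N * R)\<^sup>2 * (\<Sum>n\<le>N. (y n)\<^sup>2))"
    by (intro add_left_mono mult_left_mono sum_dyadic_field_squared_le yR y0) auto
  also have "\<dots> = (\<Sum>n\<le>N. (y n)\<^sup>2) + 4 * (h * (2 ^ N * R))\<^sup>2 * (\<Sum>n\<le>N. (y n)\<^sup>2)"
    by (simp add: power_mult_distrib)
  also have "\<dots> \<le> (\<Sum>n\<le>N. (y n)\<^sup>2) + \<epsilon> * (\<Sum>n\<le>N. (y n)\<^sup>2)"
    by (intro add_left_mono mult_right_mono \<epsilon> S)
  also have "\<dots> = (1 + \<epsilon>) * (\<Sum>n\<le>N. (y n)\<^sup>2)" by (simp add: algebra_simps)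
  \<comment> \<open>Damping divides the amplitude by \<open>1 + \<epsilon>\<close>, hence the energy
    by the square of it, whereas the undamped step multiplies the energy by at most
    \<open>1 + \<epsilon>\<close>.\<close>
  also have "\<dots> \<le> (1 + \<epsilon>)\<^sup>2 * R\<^sup>2"
    using Suc \<epsilon>0 S by (intro mult_mono) (auto simp: y_def power2_eq_square algebra_simps)
  finally have "(\<Sum>n\<le>N. (y n + h * dyadic_field y n)\<^sup>2) \<le> (1 + \<epsilon>)\<^sup>2 * R\<^sup>2" .
  moreover have "(\<Sum>n\<le>N. (damped_euler h \<epsilon> N x (Suc j) n)\<^sup>2)
      = (\<Sum>n\<le>N. (y n + h * dyadic_field y n)\<^sup>2) / (1 + \<epsilon>)\<^sup>2"
    by (simp add: y_def power_divide sum_divide_distrib)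
  moreover have "0 < (1 + \<epsilon>)\<^sup>2" using \<epsilon>0 by simp
  ultimately show ?case by (simp only: divide_le_eq mult.commute if_True)
qed

text \<open>If v is the undamped Euler update, damping changes it by
  \<open>- (\<epsilon> / (1 + \<epsilon>)) * v\<close>, and v is controlled by R and the constant
  bound on the field.\<close>

lemma damped_euler_increment:
  assumes "0 \<le> h" "0 \<le> \<epsilon>" "n \<le> N" and R: "\<And>n. \<bar>damped_euler h \<epsilon> N x j n\<bar> \<le> R"
  shows "\<bar>damped_euler h \<epsilon> N x (Suc j) n - damped_euler h \<epsilon> N x j n
      - h * dyadic_field (damped_euler h \<epsilon> N x j) n\<bar> \<le> \<epsilon> * (R + h * (2 * wavenumber n * R\<^sup>2))"
proof -
  define y where "y = damped_euler h \<epsilon> N x j"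
  define v where "v = y n + h * dyadic_field y n"
  have "\<bar>v\<bar> \<le> \<bar>y n\<bar> + h * \<bar>dyadic_field y n\<bar>"
    unfolding v_def by (rule order_trans[OF abs_triangle_ineq]) (use assms in \<open>simp add: abs_mult\<close>)
  also have "\<dots> \<le> R + h * (2 * wavenumber n * R\<^sup>2)"
    by (intro add_mono mult_left_mono abs_dyadic_field_le_const) (use assms in \<open>auto simp: y_def\<close>)
  finally have v: "\<bar>v\<bar> \<le> R + h * (2 * wavenumber n * R\<^sup>2)" .
  have "damped_euler h \<epsilon> N x (Suc j) n - y n - h * dyadic_field y n = v / (1 + \<epsilon>) - v"
    using assms by (simp add: v_def y_def)
  also have "\<dots> = - (\<epsilon> / (1 + \<epsilon>)) * v" using assms by (simp add: field_simps)
  also have "\<bar>\<dots>\<bar> = (\<epsilon> / (1 + \<epsilon>)) * \<bar>v\<bar>" using assms by (simp add: abs_mult)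
  also have "\<dots> \<le> \<epsilon> * (R + h * (2 * wavenumber n * R\<^sup>2))"
    by (intro mult_mono v) (use assms in \<open>auto simp: field_simps\<close>)
  finally show ?thesis by (simp add: y_def)
qed


text \<open>Modes above N vanish, so the energy bound extends to partial sums whose length K is
  independent of N. In this form it can be kept for fixed K while N tends to infinity.\<close>

lemma damped_euler_partial_energy:
  assumes "x 0 = 0" "0 \<le> R" "(\<Sum>n\<le>N. (x n)\<^sup>2) \<le> R\<^sup>2" "4 * (h * (2 ^ N * R))\<^sup>2 \<le> \<epsilon>"
  shows "(\<Sum>n\<le>K. (damped_euler h \<epsilon> N x j n)\<^sup>2) \<le> R\<^sup>2"
proof -
  have "(\<Sum>n\<le>K. (damped_euler h \<epsilon> N x j n)\<^sup>2) \<le> (\<Sum>n\<le>max K N. (damped_euler h \<epsilon> N x j n)\<^sup>2)"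
    by (intro sum_mono2) auto
  also have "\<dots> = (\<Sum>n\<le>N. (damped_euler h \<epsilon> N x j n)\<^sup>2)"
    by (intro sum.mono_neutral_right) auto
  also have "\<dots> \<le> R\<^sup>2" by (rule damped_euler_energy[OF assms])
  finally show ?thesis .
qed

section \<open>Expansion of grid functions along several steps\<close>

lemma grid_lipschitz:
  fixes w :: "nat \<Rightarrow> real"
  assumes "\<And>j. \<bar>w (Suc j) - w j\<bar> \<le> h * D"
  shows "\<bar>w (i + j) - w j\<bar> \<le> real i * h * D"
proof (induction i)
  case (Suc i)
  then show ?case using assms[of "i + j"] by (simp add: algebra_simps)
qed simp

text \<open>A discrete Taylor expansion. After i steps the field at mode n has drifted by at most a
  multiple of \<open>real i * h\<close>, so the next step adds an error of order
  \<open>real i * h * h\<close>; these add up to at most the square of the elapsed time. Only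
  \<open>real i * h\<close> occurs on the right, so the estimate survives refinement of the
  grid.\<close>

lemma grid_second_order:
  assumes R: "\<And>j m. \<bar>y j m\<bar> \<le> R" and h: "0 \<le> h"
    and D: "\<And>j m. m \<le> n + 1 \<Longrightarrow> \<bar>y (Suc j) m - y j m\<bar> \<le> h * D"
    and e: "\<And>j. \<bar>y (Suc j) n - y j n - h * dyadic_field (y j) n\<bar> \<le> h * e"
  shows "\<bar>y (i + j) n - y j n - real i * h * dyadic_field (y j) n\<bar>
    \<le> 4 * R * wavenumber n * D * (real i * h)\<^sup>2 + real i * h * e"
proof (induction i)
  case (Suc i)
  have R0: "0 \<le> R" using R[of 0 0] by linarith
  have hD: "0 \<le> h * D" using D[of 0 0] by linarith
  define C where "C = 4 * R * wavenumber n * D"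
  \<comment> \<open>For \<open>h = 0\<close> the sign of D is unknown, so nonnegativity is derived
    for the product through \<open>h * D\<close>.\<close>
  have C0: "0 \<le> h * h * C"
  proof -
    have "0 \<le> 4 * R * wavenumber n * h * (h * D)"
      by (intro mult_nonneg_nonneg hD R0 h) auto
    then show ?thesis by (simp add: C_def mult_ac)
  qed
  have "\<bar>dyadic_field (y (i + j)) n - dyadic_field (y j) n\<bar> \<le> 4 * R * wavenumber n * (real i * h * D)"
    by (intro dyadic_field_lipschitz R grid_lipschitz D)
  then have "h * \<bar>dyadic_field (y (i + j)) n - dyadic_field (y j) n\<bar>
      \<le> h * (4 * R * wavenumber n * (real i * h * D))"
    by (rule mult_left_mono[OF _ h])
  then have *: "\<bar>h * (dyadic_field (y (i + j)) n - dyadic_field (y j) n)\<bar> \<le> real i * (h * h * C)"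
  proof -
    have "\<bar>h * (dyadic_field (y (i + j)) n - dyadic_field (y j) n)\<bar>
        = h * \<bar>dyadic_field (y (i + j)) n - dyadic_field (y j) n\<bar>"
      using h by (simp only: abs_mult abs_of_nonneg)
    moreover have "h * (4 * R * wavenumber n * (real i * h * D)) = real i * (h * h * C)"
      by (simp only: C_def mult_ac)
    ultimately show ?thesis
      using \<open>h * \<bar>dyadic_field (y (i + j)) n - dyadic_field (y j) n\<bar>
        \<le> h * (4 * R * wavenumber n * (real i * h * D))\<close> by linarith
  qed
  have "y (Suc i + j) n - y j n - real (Suc i) * h * dyadic_field (y j) n
      = (y (i + j) n - y j n - real i * h * dyadic_field (y j) n)
        + (y (Suc (i + j)) n - y (i + j) n - h * dyadic_field (y (i + j)) n)
        + h * (dyadic_field (y (i + j)) n - dyadic_field (y j) n)"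
    by (simp add: algebra_simps)
  also have "\<bar>\<dots>\<bar> \<le> (C * (real i * h)\<^sup>2 + real i * h * e) + h * e + real i * (h * h * C)"
    using Suc.IH e[of "i + j"] * unfolding C_def[symmetric] by linarith
  also have "\<dots> \<le> C * (real (Suc i) * h)\<^sup>2 + real (Suc i) * h * e"
  proof -
    have "C * (real (Suc i) * h)\<^sup>2 = C * (real i * h)\<^sup>2 + 2 * (real i * (h * h * C)) + h * h * C"
      by (simp add: power2_eq_square algebra_simps)
    moreover have "0 \<le> real i * (h * h * C)" using C0 by simp
    ultimately show ?thesis using C0 by (simp add: algebra_simps)
  qed
  finally show ?case unfolding C_def .
qed simp

section \<open>Passage to the limit and the forward solution\<close>

lemma has_real_derivative_quadratic_error:
  fixes f :: "real \<Rightarrow> real"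
  assumes "\<And>t. t \<in> S \<Longrightarrow> \<bar>f t - f s - (t - s) * d\<bar> \<le> C * (t - s)\<^sup>2"
  shows "(f has_real_derivative d) (at s within S)"
  unfolding has_field_derivative_iff
proof (rule LIM_zero_cancel, rule Lim_null_comparison)
  show "\<forall>\<^sub>F t in at s within S. norm ((f t - f s) / (t - s) - d) \<le> C * \<bar>t - s\<bar>"
    unfolding eventually_at_filter
  proof (intro always_eventually allI impI)
    fix t assume t: "t \<noteq> s" "t \<in> S"
    have "(f t - f s) / (t - s) - d = (f t - f s - (t - s) * d) / (t - s)"
      using t by (simp add: field_simps)
    then have "norm ((f t - f s) / (t - s) - d) = \<bar>f t - f s - (t - s) * d\<bar> / \<bar>t - s\<bar>"
      by (simp add: abs_divide)
    also have "\<dots> \<le> C * (t - s)\<^sup>2 / \<bar>t - s\<bar>"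
      by (intro divide_right_mono assms t) auto
    also have "\<dots> = C * \<bar>t - s\<bar>"
      using t by (simp add: field_simps power2_eq_square flip: abs_mult)
    finally show "norm ((f t - f s) / (t - s) - d) \<le> C * \<bar>t - s\<bar>" .
  qed
  show "((\<lambda>t. C * \<bar>t - s\<bar>) \<longlongrightarrow> 0) (at s within S)"
    by (auto intro!: tendsto_eq_intros)
qed

text \<open>The number l may depend on e, yet eventual closeness makes the sequence Cauchy. It is
  applied with l the limit at a nearby rational time.\<close>

lemma convergent_if_eventually_close:
  fixes f :: "nat \<Rightarrow> real"
  assumes "\<And>e. e > 0 \<Longrightarrow> \<exists>l. \<forall>\<^sub>F i in sequentially. \<bar>f i - l\<bar> < e"
  shows "convergent f"
proof (intro Cauchy_convergent metric_CauchyI)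
  fix e :: real assume "e > 0"
  then obtain l M where "\<And>i. i \<ge> M \<Longrightarrow> \<bar>f i - l\<bar> < e / 2"
    using assms[of "e / 2"] by (auto simp: eventually_sequentially)
  then have "dist (f i) (f j) < e" if "i \<ge> M" "j \<ge> M" for i j
    using that by (smt (verit, best) dist_real_def field_sum_of_halves)
  then show "\<exists>M. \<forall>i\<ge>M. \<forall>j\<ge>M. dist (f i) (f j) < e" by blast
qed

lemma grid_index_bounds:
  fixes h t :: real
  assumes "0 < h" "0 \<le> t"
  shows "real (nat \<lfloor>t / h\<rfloor>) * h \<le> t" "t < real (nat \<lfloor>t / h\<rfloor>) * h + h"
proof -
  have "real (nat \<lfloor>t / h\<rfloor>) = of_int \<lfloor>t / h\<rfloor>" using assms by simp
  moreover have "of_int \<lfloor>t / h\<rfloor> * h \<le> t" "t < (of_int \<lfloor>t / h\<rfloor> + 1) * h"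
    using assms floor_divide_lower[of h t] floor_divide_upper[of h t] by auto
  ultimately show "real (nat \<lfloor>t / h\<rfloor>) * h \<le> t" "t < real (nat \<lfloor>t / h\<rfloor>) * h + h"
    by (simp_all add: algebra_simps)
qed


text \<open>The approximations are step functions in time, so no equation for their derivatives can pass to
  the limit; the second-order expansion around each grid point does, and gives differentiability.\<close>

lemma limit_of_approximations:
  fixes y :: "nat \<Rightarrow> nat \<Rightarrow> nat \<Rightarrow> real"
  assumes h: "\<And>N. 0 < h N" "h \<longlonglongrightarrow> 0"
    and R: "\<And>N j n. \<bar>y N j n\<bar> \<le> R"
    and y0: "\<And>N j. y N j 0 = 0"
    and inc: "\<And>n N j. n \<le> N \<Longrightarrow>
      \<bar>y N (Suc j) n - y N j n - h N * dyadic_field (y N j) n\<bar> \<le> h N * e n N"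
    and e: "\<And>n. e n \<longlonglongrightarrow> 0"
    and init: "\<And>n N. n \<le> N \<Longrightarrow> y N 0 n = x n"
    and energy: "\<And>K N j. (\<Sum>n\<le>K. (y N j n)\<^sup>2) \<le> E"
  obtains Z :: "real \<Rightarrow> nat \<Rightarrow> real" where
    "Z 0 = x" "\<And>t. 0 \<le> t \<Longrightarrow> Z t 0 = 0"
    "\<And>t n. 0 \<le> t \<Longrightarrow> ((\<lambda>s. Z s n) has_real_derivative dyadic_field (Z t) n) (at t within {0..})"
    "\<And>t K. 0 \<le> t \<Longrightarrow> (\<Sum>n\<le>K. (Z t n)\<^sup>2) \<le> E"
proof -
  have R0: "0 \<le> R" using R[of 0 0 0] by linarith
  \<comment> \<open>A bound on the speed of all modes up to n + 1: the constant bound on the field,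
    plus 1 to absorb the error \<open>e m N\<close> once it is below 1.\<close>
  define D where "D n = 2 * wavenumber (n + 1) * R\<^sup>2 + 1" for n
  have D0: "0 < D n" for n by (simp add: D_def add_nonneg_pos)
  have good: "\<forall>\<^sub>F N in sequentially. \<forall>m\<le>n + 1. \<forall>j. \<bar>y N (Suc j) m - y N j m\<bar> \<le> h N * D n" for n
  proof -
    have "\<forall>\<^sub>F N in sequentially. \<forall>m\<in>{..n + 1}. m \<le> N \<and> e m N < 1"
      by (intro eventually_ball_finite ballI eventually_conj eventually_ge_at_top
          order_tendstoD(2)[OF e]) auto
    then show ?thesis
    proof (rule eventually_mono, intro allI impI)
      fix N m j assume N: "\<forall>m\<in>{..n + 1}. m \<le> N \<and> e m N < 1" and m: "m \<le> n + 1"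
      have "\<bar>y N (Suc j) m - y N j m\<bar> \<le> h N * \<bar>dyadic_field (y N j) m\<bar> + h N * e m N"
        using inc[of m N j] N m h(1)[of N] abs_mult[of "h N" "dyadic_field (y N j) m"] by auto
      also have "\<dots> = h N * (\<bar>dyadic_field (y N j) m\<bar> + e m N)" by (simp add: algebra_simps)
      also have "\<dots> \<le> h N * D n"
      proof (rule mult_left_mono)
        have "\<bar>dyadic_field (y N j) m\<bar> \<le> 2 * wavenumber m * R\<^sup>2"
          by (rule abs_dyadic_field_le_const[OF R])
        also have "\<dots> \<le> 2 * wavenumber (n + 1) * R\<^sup>2"
          using wavenumber_mono[OF m] by (intro mult_right_mono) auto
        finally show "\<bar>dyadic_field (y N j) m\<bar> + e m N \<le> D n"
          using bspec[OF N, of m] m unfolding D_def by auto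
      qed (use h in \<open>auto intro: less_imp_le\<close>)
      finally show "\<bar>y N (Suc j) m - y N j m\<bar> \<le> h N * D n" .
    qed
  qed
  \<comment> \<open>The approximations become step functions of time, indexed by pairs of a time and
    a mode. There are countably many pairs with rational time and all values are bounded by R, so a
    diagonal subsequence converges at each of these pairs.\<close>
  define f where "f N = (\<lambda>(t, n). y N (nat \<lfloor>t / h N\<rfloor>) n)" for N
  obtain k where k: "strict_mono k"
    and k_conv: "\<And>p. p \<in> \<rat> \<times> (UNIV :: nat set) \<Longrightarrow> \<exists>l. (\<lambda>i. f (k i) p) \<longlonglongrightarrow> l"
  proof (rule function_convergent_subsequence[of "\<rat> \<times> (UNIV :: nat set)" f R])
    show "countable (\<rat> \<times> (UNIV :: nat set))" by (simp add: countable_rat)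
  qed (auto simp: f_def R)
  define J where "J i t = nat \<lfloor>t / h (k i)\<rfloor>" for i t
  define u where "u i t = y (k i) (J i t)" for i t
  have hk: "(\<lambda>i. h (k i)) \<longlonglongrightarrow> 0"
    using LIMSEQ_subseq_LIMSEQ[OF h(2) k] by (simp add: o_def)
  have J: "real (J i t) * h (k i) \<le> t" "t < real (J i t) * h (k i) + h (k i)" if "0 \<le> t" for i t
    unfolding J_def using grid_index_bounds[OF h(1) that] by auto
  have J_mono: "J i s \<le> J i t" if "s \<le> t" for i s t
    unfolding J_def using that h(1)[of "k i"]
    by (intro nat_mono floor_mono divide_right_mono) auto
  have goodk: "\<forall>\<^sub>F i in sequentially. \<forall>m\<le>n + 1. \<forall>j.
      \<bar>y (k i) (Suc j) m - y (k i) j m\<bar> \<le> h (k i) * D n" for n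
    by (rule eventually_subseq[OF k good])
  \<comment> \<open>The grid points belonging to s and t are at most
    \<open>\<bar>t - s\<bar> + h (k i)\<close> apart, so the step functions are equicontinuous up to
    one step length.\<close>
  have lip: "\<forall>\<^sub>F i in sequentially. \<forall>m\<le>n + 1. \<bar>u i t m - u i s m\<bar> \<le> D n * (\<bar>t - s\<bar> + h (k i))"
    if st: "0 \<le> s" "0 \<le> t" for s t n
    using goodk[of n]
  proof (rule eventually_mono, intro allI impI)
    fix i m assume i: "\<forall>m\<le>n + 1. \<forall>j. \<bar>y (k i) (Suc j) m - y (k i) j m\<bar> \<le> h (k i) * D n"
      and m: "m \<le> n + 1"
    have *: "\<bar>u i t m - u i s m\<bar> \<le> D n * (\<bar>t - s\<bar> + h (k i))" if st: "s \<le> t" "0 \<le> s" for s t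
    proof -
      have "\<bar>u i t m - u i s m\<bar> \<le> real (J i t - J i s) * h (k i) * D n"
        unfolding u_def
        using grid_lipschitz[of "\<lambda>j. y (k i) j m" "h (k i)" "D n" "J i t - J i s" "J i s"] i m J_mono[OF st(1)]
        by simp
      also have "\<dots> = D n * (real (J i t) * h (k i) - real (J i s) * h (k i))"
        using J_mono[OF st(1), of i] by (simp add: of_nat_diff algebra_simps)
      also have "\<dots> \<le> D n * (\<bar>t - s\<bar> + h (k i))"
        using J[of t i] J[of s i] st D0[of n] by (intro mult_left_mono) auto
      finally show ?thesis .
    qed
    show "\<bar>u i t m - u i s m\<bar> \<le> D n * (\<bar>t - s\<bar> + h (k i))"
      using *[of s t] *[of t s] st by (cases "s \<le> t") (auto simp: abs_minus_commute)
  qed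
  have conv: "convergent (\<lambda>i. u i t n)" if t: "0 \<le> t" for t n
  proof (rule convergent_if_eventually_close)
    fix \<epsilon> :: real assume \<epsilon>: "\<epsilon> > 0"
    \<comment> \<open>With q within \<open>\<delta>\<close> of t and a step below
      \<open>\<delta>\<close>, the values at t and q differ by less than
      \<open>D n * (\<delta> + \<delta>) = \<epsilon> / 2\<close>.\<close>
    define \<delta> where "\<delta> = \<epsilon> / (4 * D n)"
    have \<delta>: "\<delta> > 0" using \<epsilon> D0 by (simp add: \<delta>_def)
    obtain q where q: "q \<in> \<rat>" "t < q" "q < t + \<delta>"
      using Rats_dense_in_real[of t "t + \<delta>"] \<delta> by auto
    obtain l where l: "(\<lambda>i. u i q n) \<longlonglongrightarrow> l"
      using k_conv[of "(q, n)"] q by (auto simp: f_def u_def J_def)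
    have "\<forall>\<^sub>F i in sequentially. \<bar>u i q n - l\<bar> < \<epsilon> / 2"
      using tendstoD[OF l, of "\<epsilon> / 2"] \<epsilon> by (simp add: dist_real_def)
    moreover have "\<forall>\<^sub>F i in sequentially. h (k i) < \<delta>"
      using hk \<delta> by (rule order_tendstoD)
    moreover have "\<forall>\<^sub>F i in sequentially. \<forall>m\<le>n + 1. \<bar>u i t m - u i q m\<bar> \<le> D n * (\<bar>t - q\<bar> + h (k i))"
      using lip[of q t n] q t by auto
    ultimately have "\<forall>\<^sub>F i in sequentially. \<bar>u i t n - l\<bar> < \<epsilon>"
    proof eventually_elim
      case (elim i)
      have "\<bar>u i t n - u i q n\<bar> \<le> D n * (\<bar>t - q\<bar> + h (k i))" using elim(3) by simp
      also have "\<dots> < D n * (\<delta> + \<delta>)"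
        using q elim(2) D0[of n] by (intro mult_strict_left_mono) auto
      also have "\<dots> = \<epsilon> / 2" using D0[of n] by (simp add: \<delta>_def field_simps)
      finally show ?case using elim(1) by linarith
    qed
    then show "\<exists>l. \<forall>\<^sub>F i in sequentially. \<bar>u i t n - l\<bar> < \<epsilon>" by blast
  qed
  define Z where "Z t n = lim (\<lambda>i. u i t n)" for t n
  have uZ: "(\<lambda>i. u i t n) \<longlonglongrightarrow> Z t n" if "0 \<le> t" for t n
    using conv[OF that] by (simp add: Z_def convergent_LIMSEQ_iff)
  have ZR: "\<bar>Z t n\<bar> \<le> R" if "0 \<le> t" for t n
    by (rule tendsto_upperbound[OF tendsto_rabs[OF uZ[OF that]]]) (auto simp: u_def R)
  have Z_lip: "\<bar>Z t m - Z s m\<bar> \<le> D n * \<bar>t - s\<bar>" if "0 \<le> s" "0 \<le> t" "m \<le> n + 1" for s t m n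
  proof (rule tendsto_le)
    show "(\<lambda>i. \<bar>u i t m - u i s m\<bar>) \<longlonglongrightarrow> \<bar>Z t m - Z s m\<bar>"
      by (intro tendsto_intros uZ that)
    show "(\<lambda>i. D n * (\<bar>t - s\<bar> + h (k i))) \<longlonglongrightarrow> D n * \<bar>t - s\<bar>"
      by (auto intro!: tendsto_eq_intros hk)
    show "\<forall>\<^sub>F i in sequentially. \<bar>u i t m - u i s m\<bar> \<le> D n * (\<bar>t - s\<bar> + h (k i))"
      using lip[OF that(1,2), of n] by eventually_elim (use that in auto)
  qed simp
  define C where "C n = 4 * R * wavenumber n * D n" for n
  \<comment> \<open>The grid expansion runs forward from its base point, whence
    \<open>s \<le> t\<close>. The elapsed grid time \<open>a i\<close> differs from
    \<open>t - s\<close> by at most one step.\<close>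
  have second: "\<bar>Z t n - Z s n - (t - s) * dyadic_field (Z s) n\<bar> \<le> C n * (t - s)\<^sup>2"
    if st: "0 \<le> s" "s \<le> t" for s t n
  proof -
    define a where "a i = real (J i t - J i s) * h (k i)" for i
    have a: "a \<longlonglongrightarrow> t - s"
    proof (rule tendsto_sandwich)
      have "a i = real (J i t) * h (k i) - real (J i s) * h (k i)" for i
        using J_mono[OF st(2), of i] by (simp add: a_def of_nat_diff algebra_simps)
      then have "t - s - h (k i) \<le> a i" "a i \<le> t - s + h (k i)" for i
        using J[of t i] J[of s i] st by auto
      then show "\<forall>\<^sub>F i in sequentially. t - s - h (k i) \<le> a i" "\<forall>\<^sub>F i in sequentially. a i \<le> t - s + h (k i)"
        by simp_all
      show "(\<lambda>i. t - s - h (k i)) \<longlonglongrightarrow> t - s" "(\<lambda>i. t - s + h (k i)) \<longlonglongrightarrow> t - s"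
        by (auto intro!: tendsto_eq_intros hk)
    qed
    have ek: "(\<lambda>i. e n (k i)) \<longlonglongrightarrow> 0"
      using LIMSEQ_subseq_LIMSEQ[OF e k] by (simp add: o_def)
    show ?thesis
    proof (rule tendsto_le)
      show "(\<lambda>i. \<bar>u i t n - u i s n - a i * dyadic_field (u i s) n\<bar>)
          \<longlonglongrightarrow> \<bar>Z t n - Z s n - (t - s) * dyadic_field (Z s) n\<bar>"
        \<comment> \<open>The field at mode n involves finitely many modes, so convergence mode by
          mode suffices.\<close>
        unfolding dyadic_field_def using st by (intro tendsto_intros uZ a) auto
      show "(\<lambda>i. C n * (a i)\<^sup>2 + a i * e n (k i)) \<longlonglongrightarrow> C n * (t - s)\<^sup>2"
        by (auto intro!: tendsto_eq_intros a ek)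
      have "\<forall>\<^sub>F i in sequentially. n \<le> k i"
        by (rule eventually_subseq[OF k eventually_ge_at_top])
      then show "\<forall>\<^sub>F i in sequentially. \<bar>u i t n - u i s n - a i * dyadic_field (u i s) n\<bar>
          \<le> C n * (a i)\<^sup>2 + a i * e n (k i)"
        using goodk[of n]
      proof eventually_elim
        case (elim i)
        have "\<bar>y (k i) (J i t - J i s + J i s) n - y (k i) (J i s) n
            - real (J i t - J i s) * h (k i) * dyadic_field (y (k i) (J i s)) n\<bar>
          \<le> 4 * R * wavenumber n * D n * (real (J i t - J i s) * h (k i))\<^sup>2
            + real (J i t - J i s) * h (k i) * e n (k i)"
          using elim by (intro grid_second_order R inc less_imp_le[OF h(1)]) auto
        then show ?case
          using J_mono[OF st(2), of i] by (simp add: u_def a_def C_def)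
      qed
    qed simp
  qed
  have deriv: "((\<lambda>s. Z s n) has_real_derivative dyadic_field (Z s) n) (at s within {0..})"
    if s: "0 \<le> s" for s n
  proof (rule has_real_derivative_quadratic_error[where C = "2 * C n"])
    fix t :: real assume "t \<in> {0..}"
    then have t: "0 \<le> t" by simp
    have C0: "0 \<le> C n" using R0 D0[of n] by (auto simp: C_def)
    show "\<bar>Z t n - Z s n - (t - s) * dyadic_field (Z s) n\<bar> \<le> 2 * C n * (t - s)\<^sup>2"
    proof (cases "s \<le> t")
      case True
      then show ?thesis
        using second[OF s True, of n] C0 mult_nonneg_nonneg[OF C0, of "(t - s)\<^sup>2"] by auto
    next
      \<comment> \<open>For \<open>t < s\<close> the expansion is available at the base point t.
        Moving the field from t to s costs another \<open>C n * (t - s)^2\<close> by the Lipschitz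
        bounds, whence the factor 2 in the constant.\<close>
      case False
      have "\<bar>dyadic_field (Z t) n - dyadic_field (Z s) n\<bar> \<le> 4 * R * wavenumber n * (D n * \<bar>t - s\<bar>)"
        by (intro dyadic_field_lipschitz ZR Z_lip s t)
      then have "\<bar>t - s\<bar> * \<bar>dyadic_field (Z t) n - dyadic_field (Z s) n\<bar>
          \<le> \<bar>t - s\<bar> * (4 * R * wavenumber n * (D n * \<bar>t - s\<bar>))"
        by (rule mult_left_mono) simp
      also have "\<dots> = C n * (\<bar>t - s\<bar> * \<bar>t - s\<bar>)" by (simp only: C_def mult_ac)
      also have "\<dots> = C n * (t - s)\<^sup>2" by (simp add: power2_eq_square)
      finally have 1: "\<bar>(t - s) * (dyadic_field (Z t) n - dyadic_field (Z s) n)\<bar> \<le> C n * (t - s)\<^sup>2"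
        by (simp only: abs_mult)
      have 2: "\<bar>Z s n - Z t n - (s - t) * dyadic_field (Z t) n\<bar> \<le> C n * (t - s)\<^sup>2"
        using second[of t s n] t False by (simp add: power2_commute)
      have "Z t n - Z s n - (t - s) * dyadic_field (Z s) n
          = (t - s) * (dyadic_field (Z t) n - dyadic_field (Z s) n)
            - (Z s n - Z t n - (s - t) * dyadic_field (Z t) n)"
        by (simp add: algebra_simps)
      then show ?thesis using 1 2 by linarith
    qed
  qed
  show thesis
  proof
    show "Z 0 = x"
    proof
      fix n
      have "\<forall>\<^sub>F i in sequentially. u i 0 n = x n"
        using eventually_subseq[OF k eventually_ge_at_top[of n]]
        by eventually_elim (simp add: u_def J_def init)
      then have "(\<lambda>i. u i 0 n) \<longlonglongrightarrow> x n" by (rule tendsto_eventually)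
      then show "Z 0 n = x n" using uZ[of 0 n] LIMSEQ_unique by auto
    qed
    show "Z t 0 = 0" for t
      by (simp add: Z_def u_def y0)
    show "(\<Sum>n\<le>K. (Z t n)\<^sup>2) \<le> E" if "0 \<le> t" for t K
    proof (rule tendsto_upperbound)
      show "(\<lambda>i. \<Sum>n\<le>K. (u i t n)\<^sup>2) \<longlonglongrightarrow> (\<Sum>n\<le>K. (Z t n)\<^sup>2)"
        by (intro tendsto_intros uZ that)
    qed (auto simp: u_def energy)
  qed (rule deriv)
qed

text \<open>With step \<open>8\<^sup>-\<^sup>N\<close> the damping per unit time is of order \<open>2\<^sup>-\<^sup>N\<close>, hence disappears in the limit.\<close>

lemma finite_energy_forward_solution:
  fixes x :: "nat \<Rightarrow> real"
  assumes x0: "x 0 = 0" and R: "0 \<le> R" and xR: "\<And>N. (\<Sum>n\<le>N. (x n)\<^sup>2) \<le> R\<^sup>2"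
  obtains Z :: "real \<Rightarrow> nat \<Rightarrow> real" where
    "Z 0 = x" "\<And>t. 0 \<le> t \<Longrightarrow> Z t 0 = 0"
    "\<And>t n. 0 \<le> t \<Longrightarrow> ((\<lambda>s. Z s n) has_real_derivative dyadic_field (Z t) n) (at t within {0..})"
    "\<And>t K. 0 \<le> t \<Longrightarrow> (\<Sum>n\<le>K. (Z t n)\<^sup>2) \<le> R\<^sup>2"
proof -
  define h :: "nat \<Rightarrow> real" where "h N = (1/8) ^ N" for N
  \<comment> \<open>This is exactly the damping threshold \<open>4 * (h N * (2 ^ N * R))^2\<close>
    of the energy estimate, since \<open>h N * (2 ^ N)^2 = (1/2) ^ N\<close>. The factor
    \<open>h N\<close> is split off to show that the damping per unit time vanishes.\<close>
  define \<epsilon> where "\<epsilon> N = h N * (4 * R\<^sup>2 * (1/2) ^ N)" for N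
  define y where "y N = damped_euler (h N) (\<epsilon> N) N x" for N
  \<comment> \<open>The damping error per unit time: \<open>\<epsilon> N / h N\<close> tends to
    zero, and the bracket stays bounded for fixed n.\<close>
  define e where "e n N = 4 * R\<^sup>2 * (1/2) ^ N * (R + h N * (2 * wavenumber n * R\<^sup>2))" for n N
  have h0: "0 < h N" for N by (simp add: h_def)
  have \<epsilon>0: "0 \<le> \<epsilon> N" for N by (simp add: \<epsilon>_def h_def)
  have \<epsilon>_eq: "4 * (h N * (2 ^ N * R))\<^sup>2 = \<epsilon> N" for N
  proof -
    have "h N * (2 ^ N)\<^sup>2 = (1/2 :: real) ^ N"
      unfolding h_def by (simp add: power2_eq_square flip: power_mult_distrib)
    moreover have "4 * (h N * (2 ^ N * R))\<^sup>2 = h N * (4 * R\<^sup>2 * (h N * (2 ^ N)\<^sup>2))"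
      by (simp add: power2_eq_square mult_ac)
    ultimately show ?thesis by (simp add: \<epsilon>_def)
  qed
  have energy: "(\<Sum>n\<le>K. (y N j n)\<^sup>2) \<le> R\<^sup>2" for N j K
    unfolding y_def by (intro damped_euler_partial_energy x0 R xR) (simp add: \<epsilon>_eq)
  have yR: "\<bar>y N j n\<bar> \<le> R" for N j n
    by (rule abs_le_of_sum_squares_le[OF energy[of N j N] R]) (simp add: y_def)
  have h_lim: "h \<longlonglongrightarrow> 0" unfolding h_def by (rule LIMSEQ_power_zero) simp
  have half: "(\<lambda>N. (1/2 :: real) ^ N) \<longlonglongrightarrow> 0" by (rule LIMSEQ_power_zero) simp
  have "\<bar>y N (Suc j) n - y N j n - h N * dyadic_field (y N j) n\<bar> \<le> h N * e n N" if "n \<le> N" for n N j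
    using damped_euler_increment[of "h N" "\<epsilon> N" n N x j R] h0[of N] \<epsilon>0 that yR
    by (simp add: y_def e_def \<epsilon>_def mult.assoc)
  moreover have "e n \<longlonglongrightarrow> 0" for n
    unfolding e_def by (auto intro!: tendsto_eq_intros h_lim half)
  moreover have "y N j 0 = 0" "n \<le> N \<Longrightarrow> y N 0 n = x n" for N j n
    by (simp_all add: y_def x0)
  ultimately show thesis
    using limit_of_approximations[of h y R e x "R\<^sup>2", OF h0 h_lim yR] energy that by blast
qed

section \<open>Time reversal and comparison of energies\<close>

theorem corollary11:
  fixes t0 :: real and a :: "nat \<Rightarrow> real" and X :: "real \<Rightarrow> nat \<Rightarrow> real"
  assumes "t0 < 0"
    and "self_similar_solution t0 a X"
    and "finite_energy a"
    and "\<exists>t>t0. \<exists>n\<ge>1. X t n \<noteq> 0"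
  shows "\<forall>t1>t0. \<exists>Y. finite_energy_solution_upto t1 Y \<and> Y t1 = X t1 \<and>
           (\<forall>t\<in>{t0<..<t1}. Y t \<noteq> X t)"
proof (intro allI impI)
  fix t1 assume t1: "t1 > t0"
  have X: "X t (Suc n) = a (Suc n) / (t - t0)" and X0: "X t 0 = 0" if "t > t0" for t n
    using assms(2) that by (auto simp: self_similar_solution_def solves_system_on_def)
  define A where "A = (\<Sum>n. (a (Suc n))\<^sup>2)"
  have a: "(\<lambda>n. (a (Suc n))\<^sup>2) sums A"
    using assms(3) by (simp add: A_def finite_energy_def summable_sums)
  have X_sums: "(\<lambda>n. (X t (Suc n))\<^sup>2) sums (A / (t - t0)\<^sup>2)" if "t > t0" for t
    using sums_divide[OF a, of "(t - t0)\<^sup>2"] X[OF that] by (simp add: power_divide)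
  \<comment> \<open>Nontriviality of X enters here: a nonzero value forces a nonzero coefficient.
    Positivity of A makes the final energy comparison strict.\<close>
  have A0: "0 < A"
  proof -
    obtain t n where "t > t0" "n \<ge> 1" "X t n \<noteq> 0" using assms(4) by blast
    then have "a (Suc (n - 1)) \<noteq> 0" using X[of t "n - 1"] by auto
    then show ?thesis unfolding A_def
      using a by (intro suminf_pos2[where i = "n - 1"]) (auto intro: sums_summable)
  qed
  \<comment> \<open>The square of R is the energy of \<open>X t1\<close>, so the reversed solution
    never exceeds the energy at its end time.\<close>
  define R where "R = sqrt (A / (t1 - t0)\<^sup>2)"
  have R: "0 \<le> R" "R\<^sup>2 = A / (t1 - t0)\<^sup>2" using A0 by (simp_all add: R_def)
  have le_R: "(\<Sum>n\<le>N. (X t1 n)\<^sup>2) \<le> R\<^sup>2" for N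
  proof -
    have "(\<Sum>n\<le>N. (X t1 n)\<^sup>2) = (\<Sum>n<N. (X t1 (Suc n))\<^sup>2)"
      using X0[OF t1] by (simp add: sum.atMost_shift)
    also have "\<dots> \<le> R\<^sup>2"
      unfolding R(2) sums_unique[OF X_sums[OF t1]]
      by (intro sum_le_suminf sums_summable[OF X_sums[OF t1]]) auto
    finally show ?thesis .
  qed
  obtain Z where Z_init: "Z 0 = (\<lambda>n. - X t1 n)" and Z0: "\<And>t. 0 \<le> t \<Longrightarrow> Z t 0 = 0"
    and Z': "\<And>t n. 0 \<le> t \<Longrightarrow>
      ((\<lambda>s. Z s n) has_real_derivative dyadic_field (Z t) n) (at t within {0..})"
    and Z_energy: "\<And>t K. 0 \<le> t \<Longrightarrow> (\<Sum>n\<le>K. (Z t n)\<^sup>2) \<le> R\<^sup>2"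
  proof (rule finite_energy_forward_solution[of "\<lambda>n. - X t1 n" R])
  qed (use X0[OF t1] R(1) le_R in auto)
  define Y where "Y t = (\<lambda>n. - Z (t1 - t) n)" for t
  have Y': "((\<lambda>s. Y s n) has_real_derivative dyadic_field (Y t) n) (at t within {..t1})"
    if "t \<le> t1" for t n
  proof -
    have "((\<lambda>s. Z s n) has_real_derivative dyadic_field (Z (t1 - t)) n)
        (at (t1 - t) within (\<lambda>s. t1 - s) ` {..t1})"
      by (rule DERIV_subset[OF Z']) (use that in auto)
    moreover have "((\<lambda>s. t1 - s) has_real_derivative -1) (at t within {..t1})"
      by (auto intro!: derivative_eq_intros)
    ultimately have "((\<lambda>s. Z (t1 - s) n) has_real_derivative dyadic_field (Z (t1 - t)) n * -1)
        (at t within {..t1})"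
      by (rule DERIV_image_chain[unfolded o_def])
    then have "((\<lambda>s. - Z (t1 - s) n) has_real_derivative - (dyadic_field (Z (t1 - t)) n * -1))
        (at t within {..t1})"
      by (rule DERIV_minus)
    \<comment> \<open>The sign from reversing time cancels the sign from negating the state, and the
      field is even in the state.\<close>
    then show ?thesis by (simp add: Y_def dyadic_field_uminus)
  qed
  have Y_energy: "(\<Sum>n<K. (Y t (Suc n))\<^sup>2) \<le> R\<^sup>2" if "t \<le> t1" for t K
  proof -
    have "(\<Sum>n\<le>K. (Z (t1 - t) n)\<^sup>2) = (\<Sum>n<K. (Y t (Suc n))\<^sup>2)"
      using Z0[of "t1 - t"] that by (simp add: Y_def sum.atMost_shift)
    then show ?thesis using Z_energy[of "t1 - t" K] that by simp
  qed
  have Y_cont: "continuous_on {..t1} (\<lambda>s. Y s n)" for n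
    using Y' by (intro DERIV_continuous_on) auto
  have "continuously_differentiable_on {..t1} (\<lambda>t. Y t n)" for n
    unfolding continuously_differentiable_on_def
  proof (intro exI conjI ballI)
    show "continuous_on {..t1} (\<lambda>t. dyadic_field (Y t) n)"
      unfolding dyadic_field_def by (intro continuous_intros Y_cont)
  qed (use Y' in auto)
  moreover have "solves_system_on {..t1} Y"
    unfolding solves_system_on_def
  proof (intro conjI ballI allI impI)
    show "Y t 0 = 0" if "t \<in> {..t1}" for t
      using Z0[of "t1 - t"] that by (simp add: Y_def)
  qed (use Y' in \<open>simp add: dyadic_field_def\<close>)
  moreover have "finite_energy (Y t)" if "t \<le> t1" for t
    unfolding finite_energy_def
    by (rule summableI_nonneg_bounded[where x = "R\<^sup>2"]) (use Y_energy[OF that] in auto)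
  ultimately have "finite_energy_solution_upto t1 Y"
    by (simp add: finite_energy_solution_upto_def)
  moreover have "Y t1 = X t1" by (simp add: Y_def Z_init)
  moreover have "Y t \<noteq> X t" if t: "t \<in> {t0<..<t1}" for t
  proof
    assume "Y t = X t"
    then have "(\<Sum>n<K. (X t (Suc n))\<^sup>2) \<le> R\<^sup>2" for K
      using Y_energy[of t K] t by simp
    moreover have "(\<lambda>K. \<Sum>n<K. (X t (Suc n))\<^sup>2) \<longlonglongrightarrow> A / (t - t0)\<^sup>2"
      using X_sums[of t] t by (simp add: sums_def)
    ultimately have "A / (t - t0)\<^sup>2 \<le> R\<^sup>2"
      by (intro Lim_bounded[where M = 0]) blast+
    moreover have "A / (t1 - t0)\<^sup>2 < A / (t - t0)\<^sup>2"
      using t A0 by (intro divide_strict_left_mono power_strict_mono) auto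
    ultimately show False using R(2) by simp
  qed
  ultimately show "\<exists>Y. finite_energy_solution_upto t1 Y \<and> Y t1 = X t1 \<and>
      (\<forall>t\<in>{t0<..<t1}. Y t \<noteq> X t)" by blast
qed

end
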